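(* Every orderly topological group is c-orderly.
   Context: A circular order on a set $X$ is a ternary relation $R\subset X^3$ (write $[a,b,c]$ for $(a,b,c)\in R$) such that: (Cyclicity) $[a,b,c]\Rightarrow[b,c,a]$; (Asymmetry) $[a,b,c]\Rightarrow (b,a,c)\notin R$; (Transitivity) $[a,b,c]$ and $[a,c,d]$ imply $[a,b,d]$; (Totality) if $a,b,c$ are distinct then $[a,b,c]$ or $[a,c,b]$. Put $(a,b)_\circ=\{x: [a,x,b]\}$ and $[a,b]_\circ=(a,b)_\circ\cup\{a,b\}$. The circular topology has base $\{X\setminus[a,b]_\circ: a,b\in X\}\cup\{X\}$. The interval topology of a linearly ordered set has as subbase all rays $\{x: a<x\}$, $\{x: x<b\}$. A compact linearly (circularly) ordered space is a linearly (circularly) ordered set whose interval (circular) topology is compact, equipped with that topology. For such a space $K$, $H_+(K)$ is the group of all homeomorphisms of $K$ preserving the linear order (respectively the circular order, $[x,y,z]\Leftrightarrow[gx,gy,gz]$), with the compact-open topology. A topological group is orderly (c-orderly) if it embeds as a topological group (injective homomorphism, homeomorphism onto its image) into $H_+(K)$ for some compact linearly (circularly) ordered space $K$. *)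

theory Defs
  imports "HOL-Analysis.Analysis" "HOL-Algebra.Bij"
begin

section \<open>Linearly ordered spaces\<close>

text \<open>Orders live on an explicit carrier set \<open>K\<close>. A linear order is the library's reflexive
  \<^const>\<open>linear_order_on\<close>, so \<open>a < x\<close> reads \<open>(a, x) \<in> r \<and> a \<noteq> x\<close>. The set \<open>K\<close> itself is put into
  the generating family because it is the intersection of the empty subfamily of the subbase (for a
  one-point \<open>K\<close> the rays do not cover \<open>K\<close>).\<close>

definition interval_topology :: "'k set \<Rightarrow> ('k \<times> 'k) set \<Rightarrow> 'k topology" where
  "interval_topology K r = topology_generated_by
     (insert K ({{x \<in> K. (a, x) \<in> r \<and> a \<noteq> x} | a. a \<in> K} \<union>
                {{x \<in> K. (x, b) \<in> r \<and> x \<noteq> b} | b. b \<in> K}))"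

definition compact_linearly_ordered_space :: "'k set \<Rightarrow> ('k \<times> 'k) set \<Rightarrow> bool" where
  "compact_linearly_ordered_space K r \<longleftrightarrow>
     linear_order_on K r \<and> compact_space (interval_topology K r)"

section \<open>Circularly ordered spaces\<close>

definition circular_order_on :: "'k set \<Rightarrow> ('k \<times> 'k \<times> 'k) set \<Rightarrow> bool" where
  "circular_order_on K R \<longleftrightarrow>
     R \<subseteq> K \<times> K \<times> K \<and>
     (\<forall>a b c. (a, b, c) \<in> R \<longrightarrow> (b, c, a) \<in> R) \<and>
     (\<forall>a b c. (a, b, c) \<in> R \<longrightarrow> (b, a, c) \<notin> R) \<and>
     (\<forall>a b c d. (a, b, c) \<in> R \<longrightarrow> (a, c, d) \<in> R \<longrightarrow> (a, b, d) \<in> R) \<and>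
     (\<forall>a\<in>K. \<forall>b\<in>K. \<forall>c\<in>K. a \<noteq> b \<longrightarrow> b \<noteq> c \<longrightarrow> a \<noteq> c \<longrightarrow> (a, b, c) \<in> R \<or> (a, c, b) \<in> R)"

definition circ_open_interval :: "('k \<times> 'k \<times> 'k) set \<Rightarrow> 'k \<Rightarrow> 'k \<Rightarrow> 'k set" where
  "circ_open_interval R a b = {x. (a, x, b) \<in> R}"

definition circ_closed_interval :: "('k \<times> 'k \<times> 'k) set \<Rightarrow> 'k \<Rightarrow> 'k \<Rightarrow> 'k set" where
  "circ_closed_interval R a b = circ_open_interval R a b \<union> {a, b}"

definition circular_base :: "'k set \<Rightarrow> ('k \<times> 'k \<times> 'k) set \<Rightarrow> 'k set set" where
  "circular_base K R = insert K {K - circ_closed_interval R a b | a b. a \<in> K \<and> b \<in> K}"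

text \<open>Defined as the topology generated by \<open>circular_base K R\<close>; the lemma
  \<open>openin_circular_topology\<close> below shows that this family is a base and not merely a subbase.\<close>

definition circular_topology :: "'k set \<Rightarrow> ('k \<times> 'k \<times> 'k) set \<Rightarrow> 'k topology" where
  "circular_topology K R = topology_generated_by (circular_base K R)"

definition compact_circularly_ordered_space :: "'k set \<Rightarrow> ('k \<times> 'k \<times> 'k) set \<Rightarrow> bool" where
  "compact_circularly_ordered_space K R \<longleftrightarrow>
     circular_order_on K R \<and> compact_space (circular_topology K R)"

lemma circular_base_Int:
  assumes R: "circular_order_on K R"
    and U: "U \<in> circular_base K R" and V: "V \<in> circular_base K R" and x: "x \<in> U" "x \<in> V"
  shows "\<exists>W \<in> circular_base K R. x \<in> W \<and> W \<subseteq> U \<inter> V"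
proof (cases "U = K \<or> V = K")
  case True
  have "U \<subseteq> K" "V \<subseteq> K" using U V by (auto simp: circular_base_def)
  with True U V x show ?thesis by blast
next
  case False
  from False U obtain a b where ab: "a \<in> K" "b \<in> K" "U = K - circ_closed_interval R a b"
    by (auto simp: circular_base_def)
  from False V obtain c d where cd: "c \<in> K" "d \<in> K" "V = K - circ_closed_interval R c d"
    by (auto simp: circular_base_def)
  have xK: "x \<in> K" using x ab by auto
  have cyc: "\<And>a b c. (a, b, c) \<in> R \<Longrightarrow> (b, c, a) \<in> R"
    and asym: "\<And>a b c. (a, b, c) \<in> R \<Longrightarrow> (b, a, c) \<notin> R"
    and trans: "\<And>a b c d. (a, b, c) \<in> R \<Longrightarrow> (a, c, d) \<in> R \<Longrightarrow> (a, b, d) \<in> R"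
    and total: "\<And>a b c. a \<in> K \<Longrightarrow> b \<in> K \<Longrightarrow> c \<in> K \<Longrightarrow> a \<noteq> b \<Longrightarrow> b \<noteq> c \<Longrightarrow> a \<noteq> c \<Longrightarrow>
      (a, b, c) \<in> R \<or> (a, c, b) \<in> R"
    using R unfolding circular_order_on_def by meson+
  have irr1: "p \<noteq> q \<and> p \<noteq> y \<and> y \<noteq> q" if "(p, y, q) \<in> R" for p y q
    using that asym[OF that] asym[OF cyc[OF that]] asym[OF cyc[OF cyc[OF that]]] by auto
  txt \<open>Cutting the circle at \<open>x\<close> gives a linear order on \<open>K - {x}\<close> in which the two excluded
    closed intervals are ordinary intervals.\<close>
  define le where "le = (\<lambda>p q. p = q \<or> (x, p, q) \<in> R)"
  have le_refl: "le p p" for p unfolding le_def by simp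
  have le_trans: "le p r" if "le p q" "le q r" for p q r
    using that trans[of x p q r] unfolding le_def by auto
  have le_total: "le p q \<or> le q p" if "p \<in> K" "q \<in> K" "p \<noteq> x" "q \<noteq> x" for p q
    using total[of x p q] that xK unfolding le_def by auto
  have mem: "y \<in> circ_closed_interval R p q \<longleftrightarrow> le p y \<and> le y q"
    if "p \<in> K" "q \<in> K" "p \<noteq> x" "q \<noteq> x" "y \<in> K" "y \<noteq> x" "le p q" for p q y
  proof -
    have 1: "le p y \<and> le y q" if "(p, y, q) \<in> R"
    proof (rule ccontr)
      assume n: "\<not> (le p y \<and> le y q)"
      have ne: "p \<noteq> q" "p \<noteq> y" "y \<noteq> q" using that irr1[OF that] by auto
      have pq: "(x, p, q) \<in> R" using \<open>le p q\<close> ne unfolding le_def by simp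
      have "le y p \<or> le q y"
        using n le_total[of p y] le_total[of y q] \<open>p \<in> K\<close> \<open>q \<in> K\<close> \<open>p \<noteq> x\<close> \<open>q \<noteq> x\<close>
          \<open>y \<in> K\<close> \<open>y \<noteq> x\<close> by auto
      then show False
      proof
        assume "le y p"
        then have "(x, y, p) \<in> R" using ne unfolding le_def by auto
        then have "(p, x, y) \<in> R" using cyc[OF cyc] by simp
        then have "(p, x, q) \<in> R" using trans[OF _ that] by simp
        then show False using asym[OF pq] by simp
      next
        assume "le q y"
        then have "(x, q, y) \<in> R" using ne unfolding le_def by auto
        then have "(q, y, x) \<in> R" by (rule cyc)
        moreover have "(q, x, p) \<in> R" using cyc[OF cyc[OF pq]] .
        ultimately have "(q, y, p) \<in> R" by (rule trans)
        then have "(y, p, q) \<in> R" by (rule cyc)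
        then show False using asym[OF that] by simp
      qed
    qed
    have 2: "(p, y, q) \<in> R" if "(x, p, y) \<in> R" "(x, y, q) \<in> R"
    proof -
      have "(y, q, x) \<in> R" "(y, x, p) \<in> R" using cyc[OF that(2)] cyc[OF cyc[OF that(1)]] .
      then have "(y, q, p) \<in> R" by (rule trans)
      then show ?thesis using cyc[OF cyc] by simp
    qed
    show ?thesis
      using 1 2 \<open>le p q\<close> unfolding circ_closed_interval_def circ_open_interval_def le_def by auto
  qed
  have out: "p \<noteq> x \<and> q \<noteq> x \<and> le p q"
    if "p \<in> K" "q \<in> K" "x \<in> K - circ_closed_interval R p q" for p q
  proof -
    have ne: "p \<noteq> x" "q \<noteq> x" and "(p, x, q) \<notin> R"
      using that unfolding circ_closed_interval_def circ_open_interval_def by auto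
    have "(x, p, q) \<in> R" if "p \<noteq> q"
      using total[of p x q] ne that \<open>p \<in> K\<close> \<open>q \<in> K\<close> xK \<open>(p, x, q) \<notin> R\<close>
        cyc[of p q x] cyc[of q x p] by auto
    then show ?thesis using ne unfolding le_def by auto
  qed
  have oab: "a \<noteq> x" "b \<noteq> x" "le a b" using out[of a b] ab x by simp_all
  have ocd: "c \<noteq> x" "d \<noteq> x" "le c d" using out[of c d] cd x by simp_all
  obtain p where p: "p \<in> K" "p \<noteq> x" "le p a" "le p c"
    using le_total[of a c] ab(1) cd(1) oab(1) ocd(1) le_refl by metis
  obtain q where q: "q \<in> K" "q \<noteq> x" "le b q" "le d q"
    using le_total[of b d] ab(2) cd(2) oab(2) ocd(2) le_refl by metis
  have pq: "le p q" using le_trans[OF le_trans[OF p(3) oab(3)] q(3)] .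
  have xno: "x \<notin> circ_closed_interval R p q"
  proof
    assume "x \<in> circ_closed_interval R p q"
    then have "(p, x, q) \<in> R" using p q
      unfolding circ_closed_interval_def circ_open_interval_def by auto
    moreover from this have "p \<noteq> q" using irr1 by blast
    ultimately show False using pq asym[of p x q] unfolding le_def by auto
  qed
  have sub: "K - circ_closed_interval R p q \<subseteq> K - circ_closed_interval R s t"
    if "s \<in> K" "t \<in> K" "s \<noteq> x" "t \<noteq> x" "le s t" "le p s" "le t q"
      "x \<notin> circ_closed_interval R s t" for s t
  proof
    fix y assume y: "y \<in> K - circ_closed_interval R p q"
    show "y \<in> K - circ_closed_interval R s t"
    proof (cases "y = x")
      case True then show ?thesis using that xK by blast
    next
      case False
      then show ?thesis
        using y mem[of p q y] mem[of s t y] p q pq that le_trans[of p s y] le_trans[of y t q]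
        by auto
    qed
  qed
  have "K - circ_closed_interval R p q \<subseteq> U \<inter> V"
    using sub[of a b] sub[of c d] ab cd oab ocd p q x by simp
  moreover have "K - circ_closed_interval R p q \<in> circular_base K R"
    using p q unfolding circular_base_def by blast
  ultimately show ?thesis using xno xK by blast
qed

lemma openin_circular_topology:
  assumes R: "circular_order_on K R"
  shows "openin (circular_topology K R) = arbitrary union_of (\<lambda>B. B \<in> circular_base K R)"
proof -
  have "\<exists>B. B \<in> circular_base K R \<and> x \<in> B \<and> B \<subseteq> U"
    if "generate_topology_on (circular_base K R) U" "x \<in> U" for U x
    using that
  proof (induction arbitrary: x)
    case Empty
    then show ?case by simp
  next
    case (Int U V)
    then obtain A B where "A \<in> circular_base K R" "x \<in> A" "A \<subseteq> U"
      "B \<in> circular_base K R" "x \<in> B" "B \<subseteq> V" by (meson IntE)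
    with circular_base_Int[OF R, of A B x] show ?case by blast
  next
    case (UN \<U>)
    then show ?case by (meson Sup_upper UnionE order_trans)
  next
    case (Basis s)
    then show ?case by blast
  qed
  moreover have "openin (circular_topology K R) B" if "B \<in> circular_base K R" for B
    using that unfolding circular_topology_def by (rule topology_generated_by_Basis)
  ultimately show ?thesis
    unfolding openin_topology_base_unique
    by (simp add: circular_topology_def openin_topology_generated_by_iff)
qed

section \<open>The groups \<open>H\<^sub>+(K)\<close>\<close>

text \<open>As in \<^const>\<open>BijGroup\<close>, self-maps of \<open>K\<close> are represented by functions that are
  \<^const>\<open>undefined\<close> outside \<open>K\<close>; the group operation is composition.\<close>

definition H_plus_linear :: "'k set \<Rightarrow> ('k \<times> 'k) set \<Rightarrow> ('k \<Rightarrow> 'k) set" where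
  "H_plus_linear K r =
     {g \<in> Bij K. homeomorphic_map (interval_topology K r) (interval_topology K r) g \<and>
        (\<forall>x\<in>K. \<forall>y\<in>K. (x, y) \<in> r \<longleftrightarrow> (g x, g y) \<in> r)}"

definition H_plus_circular :: "'k set \<Rightarrow> ('k \<times> 'k \<times> 'k) set \<Rightarrow> ('k \<Rightarrow> 'k) set" where
  "H_plus_circular K R =
     {g \<in> Bij K. homeomorphic_map (circular_topology K R) (circular_topology K R) g \<and>
        (\<forall>x\<in>K. \<forall>y\<in>K. \<forall>z\<in>K. (x, y, z) \<in> R \<longleftrightarrow> (g x, g y, g z) \<in> R)}"

definition compact_open_topology :: "'k topology \<Rightarrow> ('k \<Rightarrow> 'k) set \<Rightarrow> ('k \<Rightarrow> 'k) topology" where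
  "compact_open_topology T H =
     topology_generated_by {{g \<in> H. g ` C \<subseteq> U} | C U. compactin T C \<and> openin T U}"

section \<open>Orderly and c-orderly topological groups\<close>

locale topological_group = group G for G (structure) +
  fixes T :: "'g topology"
  assumes topspace_eq_carrier: "topspace T = carrier G"
    and continuous_mult: "continuous_map (prod_topology T T) T (\<lambda>(x, y). x \<otimes> y)"
    and continuous_inv: "continuous_map T T (\<lambda>x. inv x)"

definition topological_group_embedding ::
  "('g, 'm) monoid_scheme \<Rightarrow> 'g topology \<Rightarrow> ('h, 'n) monoid_scheme \<Rightarrow> 'h topology \<Rightarrow> ('g \<Rightarrow> 'h) \<Rightarrow> bool"
  where "topological_group_embedding G T H S \<phi> \<longleftrightarrow>
     \<phi> \<in> hom G H \<and> inj_on \<phi> (carrier G) \<and> embedding_map T S \<phi>"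

text \<open>HOL cannot quantify over types inside a formula, so the type \<open>'k\<close> over which the ordered
  space \<open>K\<close> ranges is an explicit parameter.\<close>

definition orderly :: "'k itself \<Rightarrow> ('g, 'm) monoid_scheme \<Rightarrow> 'g topology \<Rightarrow> bool" where
  "orderly _ G T \<longleftrightarrow>
     (\<exists>(K :: 'k set) r \<phi>. compact_linearly_ordered_space K r \<and>
        topological_group_embedding G T
          (BijGroup K \<lparr>carrier := H_plus_linear K r\<rparr>)
          (compact_open_topology (interval_topology K r) (H_plus_linear K r)) \<phi>)"

definition c_orderly :: "'k itself \<Rightarrow> ('g, 'm) monoid_scheme \<Rightarrow> 'g topology \<Rightarrow> bool" where
  "c_orderly _ G T \<longleftrightarrow>
     (\<exists>(K :: 'k set) R \<phi>. compact_circularly_ordered_space K R \<and>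
        topological_group_embedding G T
          (BijGroup K \<lparr>carrier := H_plus_circular K R\<rparr>)
          (compact_open_topology (circular_topology K R) (H_plus_circular K R)) \<phi>)"

end

theory Submission
  imports Defs
begin

text \<open>A linear order on \<open>K\<close> induces the circular order \<open>a < b < c\<close> up to rotation. A compact
  nonempty \<open>K\<close> has a least element \<open>m\<close> and a greatest element \<open>M\<close>, and the rays are the circular
  basic sets \<open>{x. b < x} = K - [m, b]\<^sub>\<circ>\<close> and \<open>{x. x < a} = K - [a, M]\<^sub>\<circ>\<close>. So both topologies on \<open>K\<close>
  coincide, and \<open>H\<^sub>+\<close> of the linear order is a topological subgroup of \<open>H\<^sub>+\<close> of the circular order.\<close>

section \<open>Generated topologies\<close>

lemma topology_generated_by_eqI:
  assumes "\<And>s. s \<in> \<A> \<Longrightarrow> openin (topology_generated_by \<B>) s"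
    and "\<And>s. s \<in> \<B> \<Longrightarrow> openin (topology_generated_by \<A>) s"
  shows "topology_generated_by \<A> = topology_generated_by \<B>"
proof -
  \<comment> \<open>Stated for two arbitrary families, so that one argument serves both
    inclusions.\<close>
  have "openin (topology_generated_by \<D>) U"
    if "openin (topology_generated_by \<C>) U"
      and "\<And>s. s \<in> \<C> \<Longrightarrow> openin (topology_generated_by \<D>) s" for \<C> \<D> :: "'a set set" and U
    using generate_topology_on_coarsest[OF istopology_openin] that
    by (metis openin_topology_generated_by_iff)
  then show ?thesis
    using assms by (auto simp: topology_eq)
qed

text \<open>Intersecting with \<open>A\<close> commutes with finite intersections and arbitrary
  unions, so the traces of the generators generate the trace topology.\<close>

lemma subtopology_topology_generated_by:
  "subtopology (topology_generated_by \<B>) A = topology_generated_by ((\<lambda>U. U \<inter> A) ` \<B>)"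
proof -
  have 1: "generate_topology_on ((\<lambda>U. U \<inter> A) ` \<B>) (U \<inter> A)" if "generate_topology_on \<B> U" for U
    using that
  proof induction
    case Empty
    then show ?case by (simp add: generate_topology_on.Empty)
  next
    case (Int U V)
    then show ?case
      using generate_topology_on.Int[OF Int.IH] by (simp add: Int_ac)
  next
    case (UN \<U>)
    then have "generate_topology_on ((\<lambda>U. U \<inter> A) ` \<B>) (\<Union>U\<in>\<U>. U \<inter> A)"
      by (intro generate_topology_on.UN) auto
    then show ?case by simp
  next
    case (Basis U)
    then show ?case by (intro generate_topology_on.Basis) auto
  qed
  have 2: "openin (subtopology (topology_generated_by \<B>) A) U"
    if "generate_topology_on ((\<lambda>U. U \<inter> A) ` \<B>) U" for U
  proof (rule generate_topology_on_coarsest[OF istopology_openin _ that])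
    fix V assume "V \<in> (\<lambda>U. U \<inter> A) ` \<B>"
    then show "openin (subtopology (topology_generated_by \<B>) A) V"
      unfolding openin_subtopology by (auto intro: topology_generated_by_Basis)
  qed
  show ?thesis
    unfolding topology_eq openin_subtopology openin_topology_generated_by_iff
    using 1 2 unfolding openin_subtopology openin_topology_generated_by_iff by blast
qed

text \<open>The compact-open subbase of \<open>H'\<close>, cut down to \<open>H\<close>, is that of
  \<open>H\<close>. This allows groups with different carriers to be compared on a common
  subset.\<close>

lemma subtopology_compact_open_topology:
  assumes "H \<subseteq> H'"
  shows "subtopology (compact_open_topology X H') H = compact_open_topology X H"
proof -
  have "(\<lambda>U. U \<inter> H) ` {{g \<in> H'. g ` C \<subseteq> U} | C U. compactin X C \<and> openin X U} =
      {{g \<in> H'. g ` C \<subseteq> U} \<inter> H | C U. compactin X C \<and> openin X U}"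
    by (auto simp: image_iff)
  also have "\<dots> = {{g \<in> H. g ` C \<subseteq> U} | C U. compactin X C \<and> openin X U}"
  proof -
    have "{g \<in> H'. g ` C \<subseteq> U} \<inter> H = {g \<in> H. g ` C \<subseteq> U}" for C U
      using assms by auto
    then show ?thesis by simp
  qed
  finally show ?thesis
    unfolding compact_open_topology_def subtopology_topology_generated_by by simp
qed

section \<open>Compact linear orders\<close>

lemma topspace_interval_topology [simp]: "topspace (interval_topology K r) = K"
  by (auto simp: interval_topology_def)

lemma openin_interval_topology_rays:
  assumes "a \<in> K"
  shows "openin (interval_topology K r) {x \<in> K. (a, x) \<in> r \<and> a \<noteq> x}"
    and "openin (interval_topology K r) {x \<in> K. (x, a) \<in> r \<and> x \<noteq> a}"
  unfolding interval_topology_def using assms by (auto intro!: topology_generated_by_Basis)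

text \<open>Reversing the order only swaps the two families of rays. Compactness thus passes to
  \<open>r\<inverse>\<close>, whose least element is the greatest element of
  \<open>r\<close>.\<close>

lemma interval_topology_converse: "interval_topology K (r\<inverse>) = interval_topology K r"
proof -
  have "interval_topology K (r\<inverse>) = topology_generated_by
     (insert K ({{x \<in> K. (x, a) \<in> r \<and> x \<noteq> a} | a. a \<in> K} \<union>
                {{x \<in> K. (b, x) \<in> r \<and> b \<noteq> x} | b. b \<in> K}))"
    unfolding interval_topology_def converse_iff by (simp add: eq_commute)
  then show ?thesis by (simp add: interval_topology_def Un_commute)
qed

lemma linear_order_on_finite_least:
  assumes r: "linear_order_on K r" and "finite F" "F \<noteq> {}" "F \<subseteq> K"
  shows "\<exists>m\<in>F. \<forall>x\<in>F. (m, x) \<in> r"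
  using assms(2-)
proof (induction rule: finite_ne_induct)
  case (singleton x)
  then show ?case using r by (auto simp: order_on_defs refl_on_def)
next
  case (insert x F)
  then obtain m where m: "m \<in> F" "\<forall>y\<in>F. (m, y) \<in> r" by auto
  have refl: "(x, x) \<in> r" and trans: "trans r" and "(m, x) \<in> r \<or> (x, m) \<in> r"
    using r insert.prems m insert.hyps
    by (auto simp: order_on_defs refl_on_def total_on_def)
  then show ?case using m by (blast dest: transD)
qed

text \<open>Without a least element the upper rays cover \<open>K\<close>. A finite subcover then
  has a least starting point, which lies in none of its rays.\<close>

lemma compact_linearly_ordered_space_least:
  assumes "compact_linearly_ordered_space K r" "K \<noteq> {}"
  shows "\<exists>m\<in>K. \<forall>x\<in>K. (m, x) \<in> r"
proof (rule ccontr)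
  assume no_least: "\<not> (\<exists>m\<in>K. \<forall>x\<in>K. (m, x) \<in> r)"
  have r: "linear_order_on K r" and compact: "compact_space (interval_topology K r)"
    using assms by (auto simp: compact_linearly_ordered_space_def)
  define ray where "ray a = {x \<in> K. (a, x) \<in> r \<and> a \<noteq> x}" for a
  have antisym: "antisym r" and total: "total_on K r" and refl: "refl_on K r"
    using r by (auto simp: order_on_defs)
  have "K \<subseteq> \<Union>(ray ` K)"
  proof
    fix x assume "x \<in> K"
    then obtain a where "a \<in> K" "(x, a) \<notin> r" using no_least by blast
    with \<open>x \<in> K\<close> total refl have "(a, x) \<in> r" "a \<noteq> x"
      by (metis total_on_def refl_on_def)+
    with \<open>a \<in> K\<close> \<open>x \<in> K\<close> show "x \<in> \<Union>(ray ` K)" by (auto simp: ray_def)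
  qed
  moreover have "\<forall>U\<in>ray ` K. openin (interval_topology K r) U"
    using openin_interval_topology_rays(1) by (auto simp: ray_def)
  ultimately obtain \<F> where "finite \<F>" "\<F> \<subseteq> ray ` K" "K \<subseteq> \<Union>\<F>"
    using compact unfolding compact_space_alt topspace_interval_topology by meson
  then obtain F where F: "finite F" "F \<subseteq> K" "K \<subseteq> \<Union>(ray ` F)"
    using finite_subset_image by metis
  then have "F \<noteq> {}" using \<open>K \<noteq> {}\<close> by auto
  with r F obtain m where m: "m \<in> F" "\<forall>x\<in>F. (m, x) \<in> r"
    using linear_order_on_finite_least by metis
  then obtain a where "a \<in> F" "(a, m) \<in> r" "a \<noteq> m"
    using F by (auto simp: ray_def)
  with m antisym show False by (auto dest: antisymD)
qed

section \<open>The induced circular order\<close>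

text \<open>The disjuncts are the three rotations of \<open>a < b < c\<close>; distinctness makes
  the reflexive \<open>r\<close> strict.\<close>

definition circular_of_linear :: "('k \<times> 'k) set \<Rightarrow> ('k \<times> 'k \<times> 'k) set" where
  "circular_of_linear r = {(a, b, c).
     a \<noteq> b \<and> b \<noteq> c \<and> c \<noteq> a \<and>
     ((a, b) \<in> r \<and> (b, c) \<in> r \<or> (b, c) \<in> r \<and> (c, a) \<in> r \<or> (c, a) \<in> r \<and> (a, b) \<in> r)}"

text \<open>Rotating a triple permutes the three disjuncts, whence cyclicity; the other axioms are
  case checks from those of a linear order.\<close>

lemma circular_order_on_circular_of_linear:
  assumes "linear_order_on K r"
  shows "circular_order_on K (circular_of_linear r)"
proof -
  have sub: "r \<subseteq> K \<times> K" and total: "total_on K r"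
    and anti: "\<And>x y. (x, y) \<in> r \<Longrightarrow> (y, x) \<in> r \<Longrightarrow> x = y"
    and trans: "\<And>x y z. (x, y) \<in> r \<Longrightarrow> (y, z) \<in> r \<Longrightarrow> (x, z) \<in> r"
    using assms by (auto simp: order_on_defs dest: antisymD transD)
  show ?thesis
    unfolding circular_order_on_def
  proof (intro conjI allI impI ballI)
    show "circular_of_linear r \<subseteq> K \<times> K \<times> K"
      using sub by (auto simp: circular_of_linear_def)
  next
    fix a b c assume "(a, b, c) \<in> circular_of_linear r"
    then show "(b, c, a) \<in> circular_of_linear r"
      by (auto simp: circular_of_linear_def)
  next
    fix a b c assume "(a, b, c) \<in> circular_of_linear r"
    then show "(b, a, c) \<notin> circular_of_linear r"
      unfolding circular_of_linear_def by (auto dest: anti)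
  next
    fix a b c d
    assume "(a, b, c) \<in> circular_of_linear r" "(a, c, d) \<in> circular_of_linear r"
    then show "(a, b, d) \<in> circular_of_linear r"
      unfolding circular_of_linear_def using anti trans by clarsimp metis
  next
    fix a b c assume "a \<in> K" "b \<in> K" "c \<in> K" "a \<noteq> b" "b \<noteq> c" "a \<noteq> c"
    then show "(a, b, c) \<in> circular_of_linear r \<or> (a, c, b) \<in> circular_of_linear r"
      using total unfolding circular_of_linear_def total_on_def by clarsimp metis
  qed
qed

lemma circular_topology_circular_of_linear:
  assumes K: "compact_linearly_ordered_space K r"
  shows "circular_topology K (circular_of_linear r) = interval_topology K r"
proof (cases "K = {}")
  \<comment> \<open>An empty \<open>K\<close> has no endpoints; here both generating families reduce
    to the single set \<open>{}\<close>.\<close>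
  case True
  then show ?thesis
    by (simp add: circular_topology_def circular_base_def interval_topology_def)
next
  case False
  have r: "linear_order_on K r"
    using K by (simp add: compact_linearly_ordered_space_def)
  have total: "\<And>x y. x \<in> K \<Longrightarrow> y \<in> K \<Longrightarrow> (x, y) \<in> r \<or> (y, x) \<in> r"
    using r unfolding order_on_defs total_on_def refl_on_def by metis
  have anti: "\<And>x y. (x, y) \<in> r \<Longrightarrow> (y, x) \<in> r \<Longrightarrow> x = y"
    and trans: "\<And>x y z. (x, y) \<in> r \<Longrightarrow> (y, z) \<in> r \<Longrightarrow> (x, z) \<in> r"
    using r by (auto simp: order_on_defs dest: antisymD transD)
  obtain m where m: "m \<in> K" "\<And>x. x \<in> K \<Longrightarrow> (m, x) \<in> r"
    using compact_linearly_ordered_space_least[OF K False] by blast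
  have "compact_linearly_ordered_space K (r\<inverse>)"
    using K by (simp add: compact_linearly_ordered_space_def interval_topology_converse)
  from compact_linearly_ordered_space_least[OF this False]
  obtain M where M: "M \<in> K" "\<And>x. x \<in> K \<Longrightarrow> (x, M) \<in> r" by auto
  define up where "up a = {x \<in> K. (a, x) \<in> r \<and> a \<noteq> x}" for a
  define down where "down a = {x \<in> K. (x, a) \<in> r \<and> x \<noteq> a}" for a
  define compl where "compl a b = K - circ_closed_interval (circular_of_linear r) a b" for a b
  \<comment> \<open>Nothing precedes \<open>m\<close>, so the circular interval from
    \<open>m\<close> to \<open>b\<close> is the initial segment up to \<open>b\<close>; dually for
    \<open>M\<close> below.\<close>
  have up_eq: "up b = compl m b" if "b \<in> K" for b
    unfolding up_def compl_def circ_closed_interval_def circ_open_interval_def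
      circular_of_linear_def
    using m that total anti by auto
  have down_eq: "down a = compl a M" if "a \<in> K" for a
    unfolding down_def compl_def circ_closed_interval_def circ_open_interval_def
      circular_of_linear_def
    using M that total anti by auto
  \<comment> \<open>For \<open>a\<close> at most \<open>b\<close> the circular interval is the
    ordinary one, and its complement consists of two rays.\<close>
  have compl_le: "compl a b = down a \<union> up b" if "a \<in> K" "b \<in> K" "(a, b) \<in> r" for a b
    unfolding up_def down_def compl_def circ_closed_interval_def circ_open_interval_def
      circular_of_linear_def
    using that total anti trans by auto
  \<comment> \<open>For \<open>b < a\<close> the circular interval wraps past the ends of
    \<open>K\<close>, leaving the ordinary open interval from \<open>b\<close> to
    \<open>a\<close>.\<close>
  have compl_gr: "compl a b = down a \<inter> up b" if "a \<in> K" "b \<in> K" "(b, a) \<in> r" "a \<noteq> b" for a b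
    unfolding up_def down_def compl_def circ_closed_interval_def circ_open_interval_def
      circular_of_linear_def
    using that total anti trans by auto
  have "openin (interval_topology K r) (compl a b)" if "a \<in> K" "b \<in> K" for a b
  proof -
    have "openin (interval_topology K r) (down a)" "openin (interval_topology K r) (up b)"
      using that openin_interval_topology_rays by (auto simp: up_def down_def)
    then show ?thesis
      using compl_le[OF that] compl_gr[OF that] total[OF that] by (metis openin_Un openin_Int)
  qed
  moreover have "openin (interval_topology K r) K"
    using openin_topspace[of "interval_topology K r"] by simp
  moreover have "openin (circular_topology K (circular_of_linear r)) (compl a b)"
    if "a \<in> K" "b \<in> K" for a b
    using that unfolding circular_topology_def circular_base_def compl_def
    by (auto intro!: topology_generated_by_Basis)
  moreover have "openin (circular_topology K (circular_of_linear r)) K"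
    unfolding circular_topology_def circular_base_def
    by (auto intro!: topology_generated_by_Basis)
  ultimately show ?thesis
    using up_eq down_eq m(1) M(1)
    unfolding circular_topology_def interval_topology_def circular_base_def
    by (intro topology_generated_by_eqI) (auto simp: up_def down_def compl_def)
qed

section \<open>Embedding the automorphism groups\<close>

lemma H_plus_linear_subset_H_plus_circular:
  assumes "compact_linearly_ordered_space K r"
  shows "H_plus_linear K r \<subseteq> H_plus_circular K (circular_of_linear r)"
proof
  fix g assume g: "g \<in> H_plus_linear K r"
  \<comment> \<open>Injectivity transports the distinctness clauses of
    \<open>circular_of_linear\<close>.\<close>
  then have "inj_on g K"
    by (auto simp: H_plus_linear_def Bij_def bij_betw_def)
  then have "\<forall>x\<in>K. \<forall>y\<in>K. \<forall>z\<in>K.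
      (x, y, z) \<in> circular_of_linear r \<longleftrightarrow> (g x, g y, g z) \<in> circular_of_linear r"
    using g unfolding circular_of_linear_def H_plus_linear_def by (auto simp: inj_on_eq_iff)
  then show "g \<in> H_plus_circular K (circular_of_linear r)"
    using g assms by (simp add: H_plus_linear_def H_plus_circular_def
        circular_topology_circular_of_linear)
qed

theorem proposition6p1:
  fixes G :: "('g, 'm) monoid_scheme" and T :: "'g topology"
  assumes "topological_group G T"
    and "orderly TYPE('k) G T"
  shows "c_orderly TYPE('k) G T"
proof -
  interpret topological_group G T by fact
  obtain K :: "'k set" and r \<phi> where K: "compact_linearly_ordered_space K r"
    and \<phi>: "topological_group_embedding G T (BijGroup K \<lparr>carrier := H_plus_linear K r\<rparr>)
      (compact_open_topology (interval_topology K r) (H_plus_linear K r)) \<phi>"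
    using assms(2) unfolding orderly_def by blast
  define R where "R = circular_of_linear r"
  have top: "circular_topology K R = interval_topology K r"
    unfolding R_def using K by (rule circular_topology_circular_of_linear)
  have sub: "H_plus_linear K r \<subseteq> H_plus_circular K R"
    unfolding R_def using K by (rule H_plus_linear_subset_H_plus_circular)
  have "compact_circularly_ordered_space K R"
    using K top circular_order_on_circular_of_linear[of K r]
    by (simp add: compact_circularly_ordered_space_def compact_linearly_ordered_space_def R_def)
  moreover have "topological_group_embedding G T (BijGroup K \<lparr>carrier := H_plus_circular K R\<rparr>)
      (compact_open_topology (circular_topology K R) (H_plus_circular K R)) \<phi>"
    unfolding topological_group_embedding_def
  proof (intro conjI)
    have hom: "\<phi> \<in> hom G (BijGroup K \<lparr>carrier := H_plus_linear K r\<rparr>)"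
      using \<phi> by (simp add: topological_group_embedding_def)
    \<comment> \<open>Both groups inherit composition from \<open>BijGroup K\<close>, so only the
      carrier has to be enlarged.\<close>
    then show "\<phi> \<in> hom G (BijGroup K \<lparr>carrier := H_plus_circular K R\<rparr>)"
      using sub by (auto simp: hom_def)
    show "inj_on \<phi> (carrier G)"
      using \<phi> by (simp add: topological_group_embedding_def)
    \<comment> \<open>\<open>embedding_map\<close> sees the target only through its subtopology on
      the image of \<open>\<phi>\<close>. As this image lies in the smaller group, both targets
      induce the same topology there.\<close>
    have "\<phi> ` topspace T \<subseteq> H_plus_linear K r"
      using hom by (auto simp: hom_def topspace_eq_carrier)
    then have "subtopology (compact_open_topology (interval_topology K r) (H_plus_linear K r))
          (\<phi> ` topspace T) =
        subtopology (compact_open_topology (circular_topology K R) (H_plus_circular K R))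
          (\<phi> ` topspace T)"
      by (simp add: top subtopology_subtopology inf.absorb2
          flip: subtopology_compact_open_topology[OF sub])
    then show "embedding_map T
        (compact_open_topology (circular_topology K R) (H_plus_circular K R)) \<phi>"
      using \<phi> by (simp add: topological_group_embedding_def embedding_map_def)
  qed
  ultimately show ?thesis unfolding c_orderly_def by blast
qed

end
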